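(* For any real number $a>0$, one has $G(a,n)\to -a$ as $n\to\infty$ with an exponential rate of convergence; that is, there exist constants $C>0$ and $\rho\in(0,1)$ (where $C$ may depend on $a$) such that $|G(a,n)+a|\le C\rho^n$ for all $n\in\mathbb{N}$.
   Context: For $a>0$ and $n\in\mathbb{N}$, $n\ge 1$, define $$G(a,n)= a\cdot\left[-1+ \sum_{k=0}^{k_0(n)}\binom{n}{k}0.75^k\cdot 0.3^{n-k}+\left(\frac{1}{2}\right)^{n-1}\sum_{k=k_0(n)+1}^{n}\binom{n}{k}\right],\qquad k_0(n)=\left\lfloor n\cdot \frac{\ln 5-\ln 3}{\ln 5 - \ln 2}\right\rfloor,$$ where $\ln$ is the natural logarithm and $\lfloor\cdot\rfloor$ is the floor function. (Interpretation: $G(a,n)$ is the expected net profit of a player with stake $a$ after $n$ independent tosses of a fair coin, where each "heads" multiplies the score by $1.5$ and each "tails" multiplies it by $0.6$; if there are $k$ heads, the net profit is $a$ when $1.5^k\,0.6^{n-k}>1$ and $a\cdot 1.5^k\,0.6^{n-k}-a$ otherwise.) *)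

theory Defs
  imports Complex_Main
begin

text \<open>The ratio of logarithms lies in the open interval from 0 to 1, so \<open>nat\<close> does not
  truncate the floor.\<close>

definition k0 :: "nat \<Rightarrow> nat" where
  "k0 n = nat \<lfloor>real n * ((ln 5 - ln 3) / (ln 5 - ln 2) :: real)\<rfloor>"

text \<open>The quantity is only meaningful for \<open>n \<ge> 1\<close>: at \<open>n = 0\<close> the exponent \<open>n - 1\<close> is
  truncated.\<close>

definition G :: "real \<Rightarrow> nat \<Rightarrow> real" where
  "G a n = a * (- 1
     + (\<Sum>k = 0..k0 n. real (n choose k) * 0.75 ^ k * 0.3 ^ (n - k))
     + (1 / 2) ^ (n - 1) * (\<Sum>k = k0 n + 1..n. real (n choose k)))"

end

theory Submission
  imports Defs
begin

text \<open>
  Write \<open>x k = 1.5 ^ k * 0.6 ^ (n - k)\<close> for the score after \<open>k\<close> heads. The cutoff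
  \<open>k0 n\<close> is the last \<open>k\<close> with \<open>x k \<le> 1\<close>, so \<open>G a n / a + 1\<close> is
  the expectation, under the binomial distribution with parameter \<open>1/2\<close>, of the function that
  is \<open>x k\<close> up to the cutoff and \<open>2\<close> beyond it; this is at most \<open>2 * min (x k) 1\<close>. Both \<open>x\<close> (if \<open>x \<le> 1\<close>) and \<open>1\<close> (if \<open>x \<ge> 1\<close>) are bounded by \<open>sqrt x\<close>,
  and the expectation of \<open>sqrt (x k)\<close> is exactly \<open>((sqrt 1.5 + sqrt 0.6) / 2) ^ n\<close> by the
  binomial theorem. The base of this power is below \<open>1\<close>, because
  \<open>(sqrt 1.5 + sqrt 0.6)\<^sup>2 = 2.1 + 2 * sqrt 0.9\<close> and \<open>sqrt 0.9 < 0.95\<close>. This is a Chernoff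
  bound in which the exponent \<open>1/2\<close> happens to serve both sides of the cutoff.
\<close>

definition score :: "nat \<Rightarrow> nat \<Rightarrow> real" where
  "score n k = (3/2) ^ k * (3/5) ^ (n - k)"

definition decay_rate :: real where
  "decay_rate = (sqrt (3/2) + sqrt (3/5)) / 2"

lemma score_pos: "score n k > 0"
  by (simp add: score_def)

lemma ln_score:
  assumes "k \<le> n"
  shows "ln (score n k) = real k * (ln 5 - ln 2) - real n * (ln 5 - ln 3)"
  using assms
  by (simp add: score_def ln_mult ln_realpow ln_div of_nat_diff algebra_simps)

lemma k0_le: "k0 n \<le> n"
proof -
  have "(ln 5 - ln 3) / (ln 5 - ln 2) \<le> (1::real)"
    by (simp add: divide_le_eq)
  then have "real n * ((ln 5 - ln 3) / (ln 5 - ln 2)) \<le> real n"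
    using mult_left_mono[of _ 1 "real n"] by fastforce
  then show ?thesis
    unfolding k0_def by linarith
qed

lemma le_k0_iff: "k \<le> k0 n \<longleftrightarrow> real k * (ln 5 - ln 2) \<le> real n * (ln 5 - ln 3)"
proof -
  have "0 \<le> (ln 5 - ln 3) / (ln 5 - ln 2 :: real)"
    by simp
  then have "0 \<le> \<lfloor>real n * ((ln 5 - ln 3) / (ln 5 - ln 2))\<rfloor>"
    by simp
  then have "k \<le> k0 n \<longleftrightarrow> real k \<le> real n * ((ln 5 - ln 3) / (ln 5 - ln 2))"
    unfolding k0_def by linarith
  also have "\<dots> \<longleftrightarrow> real k * (ln 5 - ln 2) \<le> real n * (ln 5 - ln 3)"
    by (simp add: pos_le_divide_eq)
  finally show ?thesis .
qed

text \<open>The cutoff separates the losing scores from the winning ones: the logarithm of the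
  score is affine in \<open>k\<close>, and its zero is the number whose floor defines \<open>k0 n\<close>.\<close>

lemma score_le_1_iff:
  assumes "k \<le> n"
  shows "score n k \<le> 1 \<longleftrightarrow> k \<le> k0 n"
proof -
  have "score n k \<le> 1 \<longleftrightarrow> ln (score n k) \<le> 0"
    using score_pos by simp
  then show ?thesis
    using ln_score[OF assms] le_k0_iff by simp
qed

lemma le_sqrt_of_le_1:
  fixes x :: real
  assumes "0 \<le> x" "x \<le> 1"
  shows "x \<le> sqrt x"
  using assms by (intro real_le_rsqrt) (simp add: power2_eq_square mult_left_le)

text \<open>The mean of the square root of the score is a power, since the score is a product over
  the tosses.\<close>

lemma sum_binomial_sqrt_score:
  "(\<Sum>k\<le>n. real (n choose k) * sqrt (score n k)) = 2 ^ n * decay_rate ^ n"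
proof -
  have "2 ^ n * decay_rate ^ n = (sqrt (3/2) + sqrt (3/5)) ^ n"
    by (simp add: decay_rate_def power_divide)
  also have "\<dots> = (\<Sum>k\<le>n. real (n choose k) * sqrt (3/2) ^ k * sqrt (3/5) ^ (n - k))"
    by (rule binomial_ring)
  finally show ?thesis
    by (simp only: score_def real_sqrt_mult real_sqrt_power mult.assoc)
qed

lemma decay_rate_pos: "0 < decay_rate"
  by (simp add: decay_rate_def add_pos_pos)

lemma decay_rate_less_1: "decay_rate < 1"
proof -
  have "sqrt (3/2) * sqrt (3/5) = sqrt (9/10)"
    by (simp flip: real_sqrt_mult)
  moreover have "sqrt (9/10) < 19/20"
    by (rule real_less_lsqrt) (simp_all add: power2_eq_square)
  ultimately have "(sqrt (3/2) + sqrt (3/5))\<^sup>2 < 2\<^sup>2"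
    by (simp add: power2_sum)
  then have "sqrt (3/2) + sqrt (3/5) < 2"
    by (rule power_less_imp_less_base) simp
  then show ?thesis
    by (simp add: decay_rate_def)
qed

text \<open>The weights \<open>0.75\<close> and \<open>0.3\<close> are the score factors times the fair-coin probability
  \<open>1/2\<close>; the factor \<open>2\<close> on the tail comes from the exponent \<open>n - 1\<close> there.\<close>

lemma G_plus_stake:
  assumes "n \<ge> 1"
  shows "G a n + a =
    a * (1/2) ^ n * ((\<Sum>k = 0..k0 n. real (n choose k) * score n k)
       + 2 * (\<Sum>k = k0 n + 1..n. real (n choose k)))"
proof -
  have term_eq: "real (n choose k) * 0.75 ^ k * 0.3 ^ (n - k)
      = (1/2) ^ n * (real (n choose k) * score n k)" if "k \<le> k0 n" for k
  proof -
    have "(1/2::real) ^ n = (1/2) ^ k * (1/2) ^ (n - k)"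
      using that k0_le[of n] by (simp flip: power_add)
    moreover have "(0.75::real) ^ k = (1/2) ^ k * (3/2) ^ k"
      and "(0.3::real) ^ (n - k) = (1/2) ^ (n - k) * (3/5) ^ (n - k)"
      by (simp_all flip: power_mult_distrib)
    ultimately show ?thesis
      by (simp only: score_def mult_ac)
  qed
  have "(\<Sum>k = 0..k0 n. real (n choose k) * 0.75 ^ k * 0.3 ^ (n - k))
      = (1/2) ^ n * (\<Sum>k = 0..k0 n. real (n choose k) * score n k)"
    unfolding sum_distrib_left by (rule sum.cong) (auto simp only: term_eq atLeastAtMost_iff)
  moreover have "(1/2::real) ^ (n - 1) = 2 * (1/2) ^ n"
    using assms by (cases n) simp_all
  ultimately show ?thesis
    unfolding G_def by (simp only:) (simp add: algebra_simps)
qed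

lemma G_plus_stake_bounds:
  assumes "a > 0" "n \<ge> 1"
  shows "0 \<le> G a n + a" "G a n + a \<le> 2 * a * decay_rate ^ n"
proof -
  let ?c = "\<lambda>k. real (n choose k)"
  let ?low = "\<Sum>k = 0..k0 n. ?c k * score n k"
  let ?high = "\<Sum>k = k0 n + 1..n. ?c k"
  let ?s = "\<lambda>k. ?c k * sqrt (score n k)"
  have nonneg: "0 \<le> ?low" "0 \<le> ?high"
    by (auto intro!: sum_nonneg mult_nonneg_nonneg less_imp_le[OF score_pos])
  then show "0 \<le> G a n + a"
    using assms by (simp add: G_plus_stake)
  have low: "?low \<le> (\<Sum>k = 0..k0 n. ?s k)"
    using k0_le[of n] score_pos
    by (intro sum_mono mult_left_mono le_sqrt_of_le_1)
       (auto simp: score_le_1_iff less_imp_le)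
  have high: "?high \<le> (\<Sum>k = k0 n + 1..n. ?s k)"
  proof (rule sum_mono)
    fix k assume "k \<in> {k0 n + 1..n}"
    then have "\<not> score n k \<le> 1"
      by (simp add: score_le_1_iff)
    then show "?c k \<le> ?s k"
      by (simp add: mult_le_cancel_left1)
  qed
  have "0 \<le> (\<Sum>k = 0..k0 n. ?s k)"
    by (auto intro!: sum_nonneg mult_nonneg_nonneg less_imp_le[OF score_pos])
  with low high have "?low + 2 * ?high
      \<le> 2 * ((\<Sum>k = 0..k0 n. ?s k) + (\<Sum>k = k0 n + 1..n. ?s k))"
    by simp
  also have "(\<Sum>k = 0..k0 n. ?s k) + (\<Sum>k = k0 n + 1..n. ?s k) = (\<Sum>k = 0..n. ?s k)"
    using sum.ub_add_nat[of 0 "k0 n" ?s "n - k0 n"] k0_le[of n] by simp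
  also have "\<dots> = 2 ^ n * decay_rate ^ n"
    using sum_binomial_sqrt_score[of n] by (simp add: atLeast0AtMost)
  finally have "a * (1/2) ^ n * (?low + 2 * ?high)
      \<le> a * (1/2) ^ n * (2 * (2 ^ n * decay_rate ^ n))"
    using assms by (intro mult_left_mono) simp_all
  also have "\<dots> = 2 * a * decay_rate ^ n"
    by (simp add: power_divide)
  finally show "G a n + a \<le> 2 * a * decay_rate ^ n"
    using assms by (simp add: G_plus_stake)
qed

theorem proposition4p1:
  shows "\<exists>\<rho>::real. 0 < \<rho> \<and> \<rho> < 1 \<and>
           (\<forall>a::real. a > 0 \<longrightarrow>
              (\<lambda>n. G a n) \<longlonglongrightarrow> - a \<and>
              (\<exists>C::real. C > 0 \<and> (\<forall>n::nat. n \<ge> 1 \<longrightarrow> \<bar>G a n + a\<bar> \<le> C * \<rho> ^ n)))"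
proof (rule exI[of _ decay_rate], intro conjI allI impI)
  show "0 < decay_rate" "decay_rate < 1"
    by (fact decay_rate_pos decay_rate_less_1)+
  fix a :: real
  assume a: "a > 0"
  have bound: "\<bar>G a n + a\<bar> \<le> 2 * a * decay_rate ^ n" if "n \<ge> 1" for n
    using G_plus_stake_bounds[OF a that] by simp
  have "(\<lambda>n. 2 * a * decay_rate ^ n) \<longlonglongrightarrow> 0"
    using decay_rate_pos decay_rate_less_1
    by (intro tendsto_mult_right_zero LIMSEQ_realpow_zero) simp_all
  then have "(\<lambda>n. G a n + a) \<longlonglongrightarrow> 0"
    by (rule tendsto_0_le[where K = 1])
       (use a bound decay_rate_pos in \<open>auto simp: eventually_sequentially abs_mult\<close>)
  then show "(\<lambda>n. G a n) \<longlonglongrightarrow> - a"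
    using tendsto_add[of _ 0 _ "\<lambda>_. - a" "- a"] by fastforce
  show "\<exists>C. C > 0 \<and> (\<forall>n. n \<ge> 1 \<longrightarrow> \<bar>G a n + a\<bar> \<le> C * decay_rate ^ n)"
    using a bound by (intro exI[of _ "2 * a"]) simp
qed

end
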